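(* Let $D=(V,A)$ be a digraph and let $S\subseteq V$ be a stable set. Then $S$ is sink-stable if and only if $|S\cap V(C)|\le \eta(C)$ for every circuit $C$ of $D$.
   Context: Digraphs are finite; parallel and oppositely directed edges are allowed. A set of nodes is stable if no two of its nodes are joined by an edge (i.e. it is stable in the underlying undirected graph). A directed cut (dicut) of a digraph is the set of edges entering a subset $Z$ of nodes, provided no edge leaves $Z$. A sink node is a node with no leaving edge; a sink set is a set of nodes each of which is a sink. A set $S\subseteq V$ is sink-stable in $D$ if there are pairwise edge-disjoint dicuts of $D$ such that, after reversing the orientation of all edges of these dicuts, $S$ becomes a sink set. A circuit $C$ of $D$ is a subdigraph whose underlying undirected graph is a circuit (connected with every degree equal to 2; its edges may be oriented arbitrarily, and two edges joining the same two nodes form a circuit); $V(C)$ is its node-set. Traversing $C$ in one of its two directions, each edge is forward or backward according to whether it is traversed along or against its orientation; $\eta(C)$ is the minimum of the number of forward edges and the number of backward edges of $C$ (this does not depend on the direction of traversal; it is $0$ exactly when $C$ is a directed circuit). *)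

theory Defs
  imports "Graph_Theory.Graph_Theory"
begin

text \<open>
  Finite digraphs are those of locale \<^locale>\<open>fin_digraph\<close>, which allows parallel and oppositely
  directed arcs (\<^locale>\<open>digraph\<close> would exclude parallel ones). It also allows loops: a loop at a
  node leaves that node, so the node is not a sink; a loop enters and leaves no set \<open>Z\<close>; and
  it contributes 2 to the degree of its node, so that it forms a circuit.
\<close>

definition stable_set :: "('a, 'b) pre_digraph \<Rightarrow> 'a set \<Rightarrow> bool" where
  "stable_set D S \<longleftrightarrow> S \<subseteq> verts D \<and>
     (\<forall>u\<in>S. \<forall>v\<in>S. u \<noteq> v \<longrightarrow> \<not> (\<exists>a\<in>arcs D. tail D a = u \<and> head D a = v))"

definition entering_arcs :: "('a, 'b) pre_digraph \<Rightarrow> 'a set \<Rightarrow> 'b set" where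
  "entering_arcs D Z = {a \<in> arcs D. tail D a \<notin> Z \<and> head D a \<in> Z}"

definition leaving_arcs :: "('a, 'b) pre_digraph \<Rightarrow> 'a set \<Rightarrow> 'b set" where
  "leaving_arcs D Z = {a \<in> arcs D. tail D a \<in> Z \<and> head D a \<notin> Z}"

definition dicut :: "('a, 'b) pre_digraph \<Rightarrow> 'b set \<Rightarrow> bool" where
  "dicut D B \<longleftrightarrow> (\<exists>Z \<subseteq> verts D. leaving_arcs D Z = {} \<and> B = entering_arcs D Z)"

definition reverse_arcs :: "('a, 'b) pre_digraph \<Rightarrow> 'b set \<Rightarrow> ('a, 'b) pre_digraph" where
  "reverse_arcs D R = D\<lparr>
     tail := (\<lambda>a. if a \<in> R then head D a else tail D a),
     head := (\<lambda>a. if a \<in> R then tail D a else head D a)\<rparr>"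

definition sink_node :: "('a, 'b) pre_digraph \<Rightarrow> 'a \<Rightarrow> bool" where
  "sink_node D v \<longleftrightarrow> v \<in> verts D \<and> out_arcs D v = {}"

definition sink_set :: "('a, 'b) pre_digraph \<Rightarrow> 'a set \<Rightarrow> bool" where
  "sink_set D S \<longleftrightarrow> (\<forall>v\<in>S. sink_node D v)"

definition sink_stable :: "('a, 'b) pre_digraph \<Rightarrow> 'a set \<Rightarrow> bool" where
  "sink_stable D S \<longleftrightarrow>
     (\<exists>\<B>. (\<forall>B\<in>\<B>. dicut D B) \<and> pairwise disjnt \<B> \<and> sink_set (reverse_arcs D (\<Union>\<B>)) S)"

definition circuit :: "('a, 'b) pre_digraph \<Rightarrow> ('a, 'b) pre_digraph \<Rightarrow> bool" where
  "circuit D C \<longleftrightarrow> subgraph C D \<and> connected C \<and>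
     (\<forall>v\<in>verts C. in_degree C v + out_degree C v = 2)"

text \<open>
  A step \<open>(a, True)\<close> passes along the arc \<open>a\<close> (forward), a step \<open>(a, False)\<close> against it (backward).
  A traversal of a circuit is a closed sequence of steps using every arc exactly once; it
  fixes a starting point and one of the two directions.
\<close>

fun step_start :: "('a, 'b) pre_digraph \<Rightarrow> 'b \<times> bool \<Rightarrow> 'a" where
  "step_start C (a, fwd) = (if fwd then tail C a else head C a)"

fun step_end :: "('a, 'b) pre_digraph \<Rightarrow> 'b \<times> bool \<Rightarrow> 'a" where
  "step_end C (a, fwd) = (if fwd then head C a else tail C a)"

definition traversal :: "('a, 'b) pre_digraph \<Rightarrow> ('b \<times> bool) list \<Rightarrow> bool" where
  "traversal C p \<longleftrightarrow> distinct (map fst p) \<and> set (map fst p) = arcs C \<and>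
     (\<forall>i < length p. step_end C (p ! i) = step_start C (p ! (Suc i mod length p)))"

definition num_forward :: "('b \<times> bool) list \<Rightarrow> nat" where
  "num_forward p = length (filter snd p)"

definition num_backward :: "('b \<times> bool) list \<Rightarrow> nat" where
  "num_backward p = length (filter (\<lambda>s. \<not> snd s) p)"

text \<open>
  Every circuit has a traversal. Changing the starting point preserves both counts and changing
  the direction swaps them, so for a circuit the description below denotes a unique number.
\<close>

definition eta :: "('a, 'b) pre_digraph \<Rightarrow> nat" where
  "eta C = (THE n. \<exists>p. traversal C p \<and> n = min (num_forward p) (num_backward p))"

end

theory Submission
  imports Defs
begin

text \<open>
  Sink-stability is the feasibility of a system of difference constraints, and the circuits that
  violate the inequality are the negative cycles obstructing it.

  Disjoint dicuts given by node sets \<open>Z\<^sub>1, Z\<^sub>2, \<dots>\<close> are encoded by the potential \<open>\<pi>\<close> that counts,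
  for every node, the sets containing it: along an arc \<open>\<pi>\<close> rises by 1 if the arc lies in one of
  the dicuts and stays constant otherwise. Conversely, if an integer potential rises by 0 or 1
  along every arc, its upper level sets give disjoint dicuts. After the reversal \<open>S\<close> is a sink set
  iff \<open>\<pi>\<close> rises by 1 on the arcs leaving a node of \<open>S\<close> and by 0 on those entering one. All this
  is the single requirement that every step, along or against an arc, raises \<open>\<pi>\<close> by at most
  its cost, which is 1 for a forward step and 0 for a backward one, diminished by 1 if the step
  ends in \<open>S\<close> (\<open>sink_stable_iff_potential\<close>).

  By Gallai's theorem such a potential exists iff no cycle of steps has negative cost
  (\<open>potential_if_no_negative_cycle\<close> is the nontrivial half). A cycle with pairwise distinct
  arcs is a traversal of a circuit \<open>C\<close>, and its cost is the number of its forward steps minus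
  \<open>card (S \<inter> verts C)\<close>; for the opposite traversal the backward steps count. Both are nonnegative
  exactly if the inequality with \<open>eta C\<close> holds. The only other cycles pass along one arc and
  straight back; they cost at least 0 because a stable set contains at most one of two adjacent nodes
  (\<open>cycle_cost_nonneg\<close>).

  It remains to justify that \<open>eta\<close> is read off from any traversal: a circuit has a traversal
  (\<open>traversal_exists\<close>), and two traversals use the same steps or opposite ones
  (\<open>traversals_agree_or_opposite\<close>).
\<close>

section \<open>The digraph of steps\<close>

text \<open>
  Directed walks and cycles of this digraph are the walks and cycles of \<open>D\<close> that ignore orientation.
\<close>

definition step_digraph :: "('a, 'b) pre_digraph \<Rightarrow> ('a, 'b \<times> bool) pre_digraph" where
  "step_digraph D = \<lparr>verts = verts D, arcs = arcs D \<times> UNIV,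
     tail = step_start D, head = step_end D\<rparr>"

lemma step_digraph_simps [simp]:
  "verts (step_digraph D) = verts D" "arcs (step_digraph D) = arcs D \<times> UNIV"
  "tail (step_digraph D) = step_start D" "head (step_digraph D) = step_end D"
  by (simp_all add: step_digraph_def)

lemma wf_step_digraph: "wf_digraph D \<Longrightarrow> wf_digraph (step_digraph D)"
  by (auto simp: wf_digraph_def)

lemma fin_step_digraph:
  assumes "fin_digraph D"
  shows "fin_digraph (step_digraph D)"
proof -
  interpret fin_digraph D by fact
  interpret W: wf_digraph "step_digraph D" by (rule wf_step_digraph) unfold_locales
  show ?thesis by unfold_locales auto
qed

text \<open>
  Connectedness is defined through the symmetric closure, which forgets parallel arcs. It has the
  same adjacency relation as the step digraph, whose walks still name the arcs they use.
\<close>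

lemma connected_iff_strongly_connected_step_digraph:
  "connected C \<longleftrightarrow> strongly_connected (step_digraph C)"
proof -
  have "arcs_ends (step_digraph C) = parcs (mk_symmetric C)"
    by (force simp: arcs_ends_def arc_to_ends_def parcs_mk_symmetric)
  then have "reachable (step_digraph C) = reachable (with_proj (mk_symmetric C))"
    by (simp add: reachable_def fun_eq_iff)
  then show ?thesis
    by (simp add: connected_def strongly_connected_def)
qed

lemma step_ends_cong:
  assumes "tail C = tail D" "head C = head D"
  shows "step_start C = step_start D" "step_end C = step_end D"
  using assms by (auto simp: fun_eq_iff)

lemma cyclic_chain_iff_rotate1:
  "(\<forall>i<length p. f (p ! i) = g (p ! (Suc i mod length p))) \<longleftrightarrow> map f p = rotate1 (map g p)"
proof -
  have "rotate1 (map g p) ! i = g (p ! (Suc i mod length p))" if "i < length p" for i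
  proof -
    have "Suc i mod length p < length p" using that by (intro mod_less_divisor) linarith
    then show ?thesis using that by (simp add: nth_rotate1)
  qed
  moreover have "map f p = rotate1 (map g p) \<longleftrightarrow>
      (\<forall>i<length p. map f p ! i = rotate1 (map g p) ! i)"
    by (simp add: list_eq_iff_nth_eq)
  ultimately show ?thesis by (metis nth_map)
qed

lemma cas_imp_shift:
  assumes "pre_digraph.cas G u p v"
  shows "u # map (head G) p = map (tail G) p @ [v]"
proof -
  interpret pre_digraph G .
  show ?thesis using assms by (induction p arbitrary: u) auto
qed

lemma closed_cas_imp_rotate1:
  assumes "pre_digraph.cas G u p u" "p \<noteq> []"
  shows "map (head G) p = rotate1 (map (tail G) p)"
  using cas_imp_shift[OF assms(1)] assms(2) by (cases p) auto

lemma traversal_iff_rotate1: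
  "traversal C p \<longleftrightarrow> distinct (map fst p) \<and> set (map fst p) = arcs C \<and>
     map (step_end C) p = rotate1 (map (step_start C) p)"
  by (simp only: traversal_def cyclic_chain_iff_rotate1)

lemma mset_ends_eq_starts:
  fixes f g :: "'a \<Rightarrow> 'b"
  assumes "map f p = rotate1 (map g p)"
  shows "mset (map f p) = mset (map g p)"
proof -
  have "mset (rotate1 xs) = mset xs" for xs :: "'b list" by (cases xs) simp_all
  then show ?thesis by (simp only: assms)
qed

section \<open>Potentials and negative cycles\<close>

text \<open>
  Take for \<open>\<pi> v\<close> the least cost of a path, from anywhere, to \<open>v\<close>. Restricting to paths makes the
  minimum range over a finite set. The inequality for an arc \<open>e\<close> from \<open>x\<close> to \<open>y\<close> holds since a
  cheapest path to \<open>x\<close> either extends by \<open>e\<close> to a path to \<open>y\<close>, or already passes through \<open>y\<close>; then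
  its part after \<open>y\<close> together with \<open>e\<close> is a cycle, which can be cut off without increasing the cost.
\<close>

lemma (in fin_digraph) potential_if_no_negative_cycle:
  fixes w :: "'b \<Rightarrow> int"
  assumes nonneg: "\<And>p. cycle p \<Longrightarrow> 0 \<le> sum_list (map w p)"
  shows "\<exists>\<pi>. \<forall>e\<in>arcs G. \<pi> (head G e) \<le> \<pi> (tail G e) + w e"
proof -
  define costs where "costs v = {sum_list (map w p) |u p. apath u p v}" for v
  define \<pi> where "\<pi> v = Min (costs v)" for v
  have fin: "finite (costs v)" for v
  proof -
    have "costs v \<subseteq> (\<lambda>(u, p, v). sum_list (map w p)) ` {(u, p, v). apath u p v}"
      by (force simp: costs_def)
    then show ?thesis by (rule finite_subset) (simp add: apaths_finite_triple)
  qed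
  have le: "\<pi> v \<le> sum_list (map w p)" if "apath u p v" for u p v
    unfolding \<pi>_def by (rule Min_le[OF fin]) (use that in \<open>auto simp: costs_def\<close>)
  have "\<pi> (head G e) \<le> \<pi> (tail G e) + w e" if e: "e \<in> arcs G" for e
  proof -
    let ?x = "tail G e" and ?y = "head G e"
    have "apath ?x [] ?x" using e by (simp add: apath_Nil_iff)
    then have "costs ?x \<noteq> {}" by (auto simp: costs_def)
    then have "\<pi> ?x \<in> costs ?x" unfolding \<pi>_def by (rule Min_in[OF fin])
    then obtain u p where p: "apath u p ?x" and cost: "\<pi> ?x = sum_list (map w p)"
      by (auto simp: costs_def)
    have ap: "awalk u p ?x" using p by (rule awalkI_apath)
    show ?thesis
    proof (cases "?y \<in> set (awalk_verts u p)")
      case False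
      have "apath u (p @ [e]) ?y"
        using p False e ap
        by (auto simp: apath_def awalk_simps awalk_verts_append[of u p "[e]" ?y])
      from le[OF this] show ?thesis by (simp add: cost)
    next
      case True
      then obtain q r where pqr: "p = q @ r" and q: "awalk u q ?y" and r: "awalk ?y r ?x"
        using awalk_decomp[OF ap] by blast
      have aq: "apath u q ?y" and ar: "apath ?y r ?x"
        using p q unfolding pqr by (auto simp: apath_append_iff)
      have c: "awalk ?y (r @ [e]) ?y"
        using r e by (auto simp: awalk_simps)
      have "awalk_verts ?y (r @ [e]) = awalk_verts ?y r @ [?y]"
        using awalk_verts_append[OF c] by simp
      moreover have "awalk_verts ?y r = ?y # tl (awalk_verts ?y r)"
        using r by (metis awalk_verts_non_Nil awhd_of_awalk list.collapse)
      ultimately have "distinct (tl (awalk_verts ?y (r @ [e])))"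
        using ar by (metis apath_def append_Cons distinct.simps(2) distinct1_rotate list.sel(3) rotate1.simps(2))
      then have "cycle (r @ [e])"
        using c by (auto simp: cycle_def)
      from nonneg[OF this] le[OF aq] show ?thesis
        by (simp add: cost pqr)
    qed
  qed
  then show ?thesis by blast
qed

section \<open>Traversals of circuits\<close>

text \<open>
  Whatever its direction, a step uses up both ends of its arc. This turns the degree condition on
  circuits into a bound on the number of visits of a walk that repeats no arc.
\<close>

lemma count_ends_plus_starts:
  fixes G :: "('a, 'b) pre_digraph"
  assumes "distinct (map fst p)"
  shows "count_list (map (step_end G) p) v + count_list (map (step_start G) p) v =
    card {a \<in> fst ` set p. head G a = v} + card {a \<in> fst ` set p. tail G a = v}"
  using assms
proof (induction p)
  case (Cons s p)
  obtain a b where s: "s = (a, b)" by force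
  have a: "a \<notin> fst ` set p" using Cons.prems by (simp add: s)
  have ins: "card {x \<in> insert a (fst ` set p). h x = v} =
      of_bool (h a = v) + card {x \<in> fst ` set p. h x = v}" for h :: "'b \<Rightarrow> 'a"
  proof (cases "h a = v")
    case True
    then have "{x \<in> insert a (fst ` set p). h x = v} = insert a {x \<in> fst ` set p. h x = v}" by auto
    then show ?thesis using a True by simp
  next
    case False
    then have "{x \<in> insert a (fst ` set p). h x = v} = {x \<in> fst ` set p. h x = v}" by auto
    then show ?thesis using False by simp
  qed
  show ?case using Cons ins[of "head G"] ins[of "tail G"] by (simp add: s)
qed simp

text \<open>
  A closed walk enters a vertex as often as it leaves it, and if it uses all arcs, the entries and
  exits at a vertex add up to the degree 2.
\<close>

lemma traversal_visits_each_vertex_once: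
  assumes C: "wf_digraph C" "\<And>v. v \<in> verts C \<Longrightarrow> in_degree C v + out_degree C v = 2"
    and p: "traversal C p"
  shows "distinct (map (step_end C) p)" "step_end C ` set p = verts C"
    "distinct (map (step_start C) p)" "step_start C ` set p = verts C"
proof -
  interpret wf_digraph C by fact
  have arcs: "fst ` set p = arcs C" and dist: "distinct (map fst p)"
    using p by (auto simp: traversal_def)
  have ms: "mset (map (step_end C) p) = mset (map (step_start C) p)"
    using p by (intro mset_ends_eq_starts) (simp add: traversal_iff_rotate1)
  then have same: "count_list (map (step_end C) p) v = count_list (map (step_start C) p) v" for v
    by (metis count_mset)
  have one: "count_list (map (step_end C) p) v = 1" if "v \<in> verts C" for v
    using count_ends_plus_starts[OF dist, of C v] C(2)[OF that] same[of v]
    by (simp add: arcs in_degree_def out_degree_def in_arcs_def out_arcs_def)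
  have sub: "step_end C ` set p \<subseteq> verts C"
    using arcs by force
  show set: "step_end C ` set p = verts C"
  proof (rule antisym[OF sub], rule subsetI)
    fix v assume "v \<in> verts C"
    from one[OF this] have "count_list (map (step_end C) p) v \<noteq> 0" by simp
    then show "v \<in> step_end C ` set p" by (metis count_notin list.set_map)
  qed
  show dist_end: "distinct (map (step_end C) p)"
    unfolding distinct_count_atmost_1 using one set
    by (metis count_list_0_iff count_mset image_set)
  show "distinct (map (step_start C) p)"
    using ms dist_end by (metis mset_eq_imp_distinct_iff)
  show "step_start C ` set p = verts C"
    using ms set by (metis image_set mset_eq_setD)
qed

lemma circuitD:
  assumes "circuit D C"
  shows "wf_digraph C" "tail C = tail D" "head C = head D" "arcs C \<subseteq> arcs D"
    "verts C \<subseteq> verts D" "verts C \<noteq> {}" "strongly_connected (step_digraph C)"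
    "\<And>v. v \<in> verts C \<Longrightarrow> in_degree C v + out_degree C v = 2"
  using assms
  by (auto simp: circuit_def subgraph_def compatible_def connected_iff_strongly_connected_step_digraph
      strongly_connected_def)

text \<open>
  A longest trail is closed: at a final vertex different from the initial one it uses an odd number
  of the two arc ends, so it could be extended. Being closed, it uses both arc ends at every vertex
  it visits, hence by connectedness it visits every vertex and uses every arc.
\<close>

lemma traversal_exists:
  fixes C :: "('a, 'b) pre_digraph"
  assumes fin: "finite (arcs C)" and wf: "wf_digraph C"
    and conn: "strongly_connected (step_digraph C)"
    and deg: "\<And>v. v \<in> verts C \<Longrightarrow> in_degree C v + out_degree C v = 2"
  shows "\<exists>p. traversal C p"
proof -
  interpret wf_digraph C by fact
  interpret W: wf_digraph "step_digraph C" using wf by (rule wf_step_digraph)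
  have deg': "card {a \<in> arcs C. head C a = v} + card {a \<in> arcs C. tail C a = v} = 2"
    if "v \<in> verts C" for v
    using deg[OF that] by (simp add: in_degree_def out_degree_def in_arcs_def out_arcs_def)
  define T where "T p \<longleftrightarrow> p \<noteq> [] \<and> distinct (map fst p) \<and> (\<exists>u v. W.awalk u p v)" for p
  obtain x where "x \<in> verts C" using conn by (auto simp: strongly_connected_def)
  from deg'[OF this] obtain a where a: "a \<in> arcs C"
    by (metis (no_types, lifting) card.empty empty_Collect_eq add_0 zero_neq_numeral)
  have ex: "T [(a, True)]" using a by (auto simp: T_def W.awalk_simps)
  have bound: "length p < Suc (card (arcs C))" if "T p" for p
  proof -
    have "set (map fst p) \<subseteq> arcs C"
      using that by (force simp: T_def W.awalk_def)
    then have "card (set (map fst p)) \<le> card (arcs C)" using fin by (rule card_mono[rotated])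
    then show ?thesis using that by (simp only: distinct_card T_def) simp
  qed
  obtain p where p: "T p" and max: "\<And>q. T q \<Longrightarrow> length q \<le> length p"
    using ex_has_greatest_nat[of T _ length, OF ex] bound by (metis less_imp_le_nat)
  then obtain u v where ne: "p \<noteq> []" and dist: "distinct (map fst p)" and walk: "W.awalk u p v"
    by (auto simp: T_def)
  let ?A = "fst ` set p"
  have AC: "?A \<subseteq> arcs C" using walk by (force simp: W.awalk_def)
  note cnt = count_ends_plus_starts[OF dist, of C]
  have le: "card {a \<in> ?A. h a = x} \<le> card {a \<in> arcs C. h a = x}" for h :: "'b \<Rightarrow> 'a" and x
    using AC fin by (intro card_mono) auto
  have sub: "{a \<in> arcs C. h a = x} \<subseteq> ?A"
    if "card {a \<in> arcs C. h a = x} \<le> card {a \<in> ?A. h a = x}" for h :: "'b \<Rightarrow> 'a" and x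
  proof -
    have "{a \<in> ?A. h a = x} = {a \<in> arcs C. h a = x}"
      using AC fin that by (intro card_seteq) auto
    then show ?thesis by blast
  qed
  have verts_uv: "u \<in> verts C" "v \<in> verts C" using walk by auto
  have bal: "of_bool (x = u) + count_list (map (step_end C) p) x =
      of_bool (x = v) + count_list (map (step_start C) p) x" for x
  proof -
    have "u # map (step_end C) p = map (step_start C) p @ [v]"
      using cas_imp_shift[of "step_digraph C"] walk by (simp add: W.awalk_def)
    from arg_cong[OF this, of "\<lambda>xs. count_list xs x"] show ?thesis
      by (auto split: if_splits)
  qed
  have closed: "u = v"
  proof (rule ccontr)
    assume "u \<noteq> v"
    then have "count_list (map (step_end C) p) v = Suc (count_list (map (step_start C) p) v)"
      using bal[of v] by simp
    then have "card {a \<in> ?A. head C a = v} + card {a \<in> ?A. tail C a = v} \<noteq> 2"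
      using cnt[of v] by presburger
    then have "{a \<in> ?A. head C a = v} \<noteq> {a \<in> arcs C. head C a = v} \<or>
        {a \<in> ?A. tail C a = v} \<noteq> {a \<in> arcs C. tail C a = v}"
      using deg'[OF verts_uv(2)] by metis
    then obtain a where a: "a \<in> arcs C" "a \<notin> ?A" "head C a = v \<or> tail C a = v"
      using AC by blast
    then obtain b where b: "step_start C (a, b) = v"
      by (metis step_start.simps)
    have "W.awalk u (p @ [(a, b)]) (step_end C (a, b))"
      using walk a b by (auto simp: W.awalk_simps)
    then have "T (p @ [(a, b)])"
      using dist a by (auto simp: T_def)
    from max[OF this] show False by simp
  qed
  have all_used: "a \<in> ?A"
    if "x \<in> step_end C ` set p" "a \<in> arcs C" "head C a = x \<or> tail C a = x" for x a
  proof -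
    have x: "x \<in> verts C" using that(2,3) by auto
    have "count_list (map (step_end C) p) x \<noteq> 0"
      using that(1) by (metis count_list_0_iff image_set)
    then have "2 \<le> card {a \<in> ?A. head C a = x} + card {a \<in> ?A. tail C a = x}"
      using bal[of x] closed cnt[of x] by simp
    then have "card {a \<in> arcs C. head C a = x} \<le> card {a \<in> ?A. head C a = x}"
      "card {a \<in> arcs C. tail C a = x} \<le> card {a \<in> ?A. tail C a = x}"
      using deg'[OF x] le[of "head C" x] le[of "tail C" x] by linarith+
    from sub[OF this(1)] sub[OF this(2)] that show ?thesis by blast
  qed
  have rot: "map (step_end C) p = rotate1 (map (step_start C) p)"
    using closed_cas_imp_rotate1[of "step_digraph C" u p] walk closed ne by (auto simp: W.awalk_def)
  have starts_ends: "step_start C ` set p = step_end C ` set p"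
    using mset_ends_eq_starts[OF rot] by (metis image_set mset_eq_setD)
  have reach: "y \<in> step_end C ` set p" if "W.awalk x q y" "x \<in> step_end C ` set p" for x q y
    using that
  proof (induction q arbitrary: x)
    case Nil then show ?case by (simp add: W.awalk_simps)
  next
    case (Cons s q)
    obtain a b where s: "s = (a, b)" by force
    have a: "a \<in> arcs C" "x = step_start C (a, b)" "W.awalk (step_end C (a, b)) q y"
      using Cons.prems by (auto simp: s W.awalk_simps)
    then have "a \<in> ?A" using all_used[OF Cons.prems(2)] by (cases b) auto
    then obtain b' where "(a, b') \<in> set p" by force
    then have "step_end C (a, b') \<in> step_end C ` set p" "step_start C (a, b') \<in> step_end C ` set p"
      using starts_ends by blast+
    then have "step_end C (a, b) \<in> step_end C ` set p"
      by (cases b; cases b') auto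
    with Cons.IH a(3) show ?case by blast
  qed
  have "u \<in> step_start C ` set p"
    using walk ne by (cases p) (auto simp: W.awalk_simps)
  then have "u \<in> step_end C ` set p" by (simp only: starts_ends)
  moreover have "\<exists>q. W.awalk u q x" if "x \<in> verts C" for x
    using conn verts_uv(1) that by (simp add: strongly_connected_def W.reachable_awalk)
  ultimately have visited: "x \<in> step_end C ` set p" if "x \<in> verts C" for x
    using reach that by metis
  have "arcs C \<subseteq> ?A"
    using all_used[OF visited[OF head_in_verts]] by blast
  then have "traversal C p"
    using AC dist rot by (auto simp: traversal_iff_rotate1)
  then show ?thesis ..
qed

lemma num_forward_conv_card:
  assumes "distinct p"
  shows "num_forward p = card {s \<in> set p. snd s}" "num_backward p = card {s \<in> set p. \<not> snd s}"
  using assms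
  by (simp_all add: num_forward_def num_backward_def distinct_length_filter Int_def conj_commute)

text \<open>
  If two traversals share a step, they also share its successor: the arc of the successor in \<open>p\<close> also
  occurs in \<open>q\<close>, and in the other direction it would end where the common step ends, although \<open>q\<close>
  enters that vertex only once. So the shared steps are all steps. If they share none, every arc
  is used in opposite directions.
\<close>

lemma traversals_agree_or_opposite:
  assumes C: "wf_digraph C" "\<And>v. v \<in> verts C \<Longrightarrow> in_degree C v + out_degree C v = 2"
    and p: "traversal C p" and q: "traversal C q"
  shows "set p = set q \<or> set q = apsnd Not ` set p"
proof (cases "set p \<inter> set q = {}")
  case True
  have same_arcs: "fst ` set p = fst ` set q" using p q by (simp add: traversal_def)
  have other: "(a, \<not> b) \<in> B"
    if "(a, b) \<in> A" "fst ` A = fst ` B" "A \<inter> B = {}" for a :: 'b and b A B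
  proof -
    have "a \<in> fst ` B" using that by force
    then obtain b' where "(a, b') \<in> B" by force
    moreover from this that have "b' \<noteq> b" by blast
    ultimately show ?thesis by (cases b; cases b') simp_all
  qed
  have "(a, b) \<in> set q \<longleftrightarrow> (a, \<not> b) \<in> set p" for a b
    using other[of a b "set q" "set p"] other[of a "\<not> b" "set p" "set q"] same_arcs True
    by (simp add: Int_commute) blast
  moreover have "(a, b) \<in> apsnd Not ` set p \<longleftrightarrow> (a, \<not> b) \<in> set p" for a b
    using image_eqI[of "(a, b)" "apsnd Not" "(a, \<not> b)" "set p"] by auto
  ultimately have "(a, b) \<in> set q \<longleftrightarrow> (a, b) \<in> apsnd Not ` set p" for a b by simp
  then show ?thesis by auto
next
  case False
  let ?n = "length p"
  have dq: "distinct (map (step_end C) q)"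
    using traversal_visits_each_vertex_once[OF C q] by simp
  have next_in: "p ! (Suc i mod ?n) \<in> set q" if i: "i < ?n" "p ! i \<in> set q" for i
  proof (rule ccontr)
    assume neg: "p ! (Suc i mod ?n) \<notin> set q"
    obtain c d where cd: "p ! (Suc i mod ?n) = (c, d)" by force
    have j: "Suc i mod ?n < ?n" using i by (cases ?n) auto
    then have "c \<in> fst ` set q" using p q cd by (metis fst_conv image_eqI nth_mem traversal_def image_set)
    then obtain d' where d': "(c, d') \<in> set q" by force
    then have flip: "d' = (\<not> d)" using neg cd by (cases d; cases d') auto
    have "step_end C (p ! i) = step_start C (c, d)"
      using p i cd by (simp add: traversal_def)
    also have "\<dots> = step_end C (c, d')" by (simp add: flip)
    finally have pi: "p ! i = (c, d')"
      using dq d' i(2) unfolding distinct_map by (blast dest: inj_onD)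
    then have "map fst p ! i = map fst p ! (Suc i mod ?n)"
      using cd i j by simp
    then have "i = Suc i mod ?n"
      using p i j by (simp add: traversal_def nth_eq_iff_index_eq del: nth_map)
    then show False using pi cd flip by simp
  qed
  from False obtain i where i: "i < ?n" "p ! i \<in> set q"
    by (metis disjoint_iff in_set_conv_nth)
  have run: "p ! ((i + k) mod ?n) \<in> set q" for k
  proof (induction k)
    case 0 then show ?case using i by simp
  next
    case (Suc k)
    have "(i + k) mod ?n < ?n" using i by (cases ?n) auto
    from next_in[OF this Suc] show ?case by (simp add: mod_Suc_eq)
  qed
  have "set p \<subseteq> set q"
  proof
    fix s assume "s \<in> set p"
    then obtain j where j: "j < ?n" "s = p ! j" by (auto simp: in_set_conv_nth)
    then have "(i + (?n - i + j)) mod ?n = j" using i by simp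
    then show "s \<in> set q" using run[of "?n - i + j"] j by simp
  qed
  moreover have "card (set p) = card (set q)"
    using p q by (metis (no_types, lifting) traversal_def card_image distinct_map image_set)
  ultimately show ?thesis by (simp add: card_subset_eq)
qed

lemma eta_eq:
  assumes C: "wf_digraph C" "\<And>v. v \<in> verts C \<Longrightarrow> in_degree C v + out_degree C v = 2"
    and p: "traversal C p"
  shows "eta C = min (num_forward p) (num_backward p)"
  unfolding eta_def
proof (rule the_equality)
  show "\<exists>q. traversal C q \<and> min (num_forward p) (num_backward p) = min (num_forward q) (num_backward q)"
    using p by blast
next
  fix n assume "\<exists>q. traversal C q \<and> n = min (num_forward q) (num_backward q)"
  then obtain q where q: "traversal C q" and n: "n = min (num_forward q) (num_backward q)" by blast
  have d: "distinct p" "distinct q" using p q by (auto simp: traversal_def distinct_map)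
  from traversals_agree_or_opposite[OF C p q]
  show "n = min (num_forward p) (num_backward p)"
  proof
    assume "set p = set q"
    then show ?thesis by (simp add: n num_forward_conv_card d)
  next
    assume s: "set q = apsnd Not ` set p"
    have inj: "inj_on (apsnd Not) X" for X :: "('b \<times> bool) set"
      by (rule inj_onI) (auto simp: prod_eq_iff)
    have "{s \<in> set q. snd s} = apsnd Not ` {s \<in> set p. \<not> snd s}"
      "{s \<in> set q. \<not> snd s} = apsnd Not ` {s \<in> set p. snd s}"
      by (force simp: s)+
    then have "num_forward q = num_backward p" "num_backward q = num_forward p"
      by (simp_all add: num_forward_conv_card d card_image[OF inj])
    then show ?thesis by (simp add: n min.commute)
  qed
qed

section \<open>Sink-stability as existence of a potential\<close>

text \<open>
  Bounding the rise of a potential by the cost of the step, for both steps along an arc from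
  \<open>u\<close> to \<open>v\<close>, confines the rise from \<open>u\<close> to \<open>v\<close> to the integers between 0 and 1; it is forced
  to be 1 if \<open>u \<in> S\<close> and to be 0 if \<open>v \<in> S\<close>.
\<close>

definition step_cost :: "('a, 'b) pre_digraph \<Rightarrow> 'a set \<Rightarrow> 'b \<times> bool \<Rightarrow> int" where
  "step_cost D S s = of_bool (snd s) - of_bool (step_end D s \<in> S)"

text \<open>
  From dicuts to potentials, count for each vertex the dicut sets containing it; from potentials to
  dicuts, take the upper level sets. An arc with rise at most 1 enters at most one level set, which
  makes these dicuts disjoint.
\<close>

lemma sink_stable_iff_potential:
  assumes D: "fin_digraph D" and S: "S \<subseteq> verts D"
  shows "sink_stable D S \<longleftrightarrow>
    (\<exists>\<pi>. \<forall>s\<in>arcs D \<times> UNIV. \<pi> (step_end D s) \<le> \<pi> (step_start D s) + step_cost D S s)"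
    (is "_ \<longleftrightarrow> (\<exists>\<pi>. ?pot \<pi>)")
proof
  interpret fin_digraph D by fact
  assume "sink_stable D S"
  then obtain \<B> where dic: "\<And>B. B \<in> \<B> \<Longrightarrow> dicut D B" and dis: "pairwise disjnt \<B>"
    and sink: "sink_set (reverse_arcs D (\<Union>\<B>)) S"
    by (auto simp: sink_stable_def)
  obtain Z where Z: "\<And>B. B \<in> \<B> \<Longrightarrow> leaving_arcs D (Z B) = {} \<and> B = entering_arcs D (Z B)"
    using dic unfolding dicut_def by metis
  have "\<B> \<subseteq> Pow (arcs D)" using Z by (force simp: entering_arcs_def)
  then have fin: "finite \<B>" by (rule finite_subset) simp
  define \<pi> where "\<pi> v = (\<Sum>B\<in>\<B>. of_bool (v \<in> Z B) :: int)" for v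
  have diff: "\<pi> (head D a) - \<pi> (tail D a) = of_bool (a \<in> \<Union>\<B>)" if a: "a \<in> arcs D" for a
  proof -
    have "\<pi> (head D a) - \<pi> (tail D a) = (\<Sum>B\<in>\<B>. of_bool (a \<in> B))"
      unfolding \<pi>_def sum_subtractf[symmetric]
    proof (rule sum.cong[OF refl])
      fix B assume "B \<in> \<B>"
      from Z[OF this] have "leaving_arcs D (Z B) = {}" "a \<in> B \<longleftrightarrow> a \<in> entering_arcs D (Z B)" by auto
      then show "of_bool (head D a \<in> Z B) - of_bool (tail D a \<in> Z B) = (of_bool (a \<in> B) :: int)"
        using a by (auto simp: leaving_arcs_def entering_arcs_def)
    qed
    also have "\<dots> = of_bool (a \<in> \<Union>\<B>)"
    proof (cases "a \<in> \<Union>\<B>")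
      case True
      then obtain B where B: "B \<in> \<B>" "a \<in> B" by blast
      have "a \<in> B' \<longleftrightarrow> B' = B" if "B' \<in> \<B>" for B'
        using dis B that by (auto simp: pairwise_def disjnt_def)
      then have "(\<Sum>B'\<in>\<B>. of_bool (a \<in> B')) = (\<Sum>B'\<in>\<B>. of_bool (B' = B) :: int)"
        by (intro sum.cong) auto
      also have "\<dots> = 1" using fin B by (simp add: of_bool_def)
      finally show ?thesis using True by simp
    qed (auto intro: sum.neutral)
    finally show ?thesis .
  qed
  have rev: "head D a \<notin> S \<or> a \<notin> \<Union>\<B>" "tail D a \<notin> S \<or> a \<in> \<Union>\<B>" if "a \<in> arcs D" for a
  proof -
    have "(if a \<in> \<Union>\<B> then head D a else tail D a) \<notin> S"
      using sink that by (force simp: sink_set_def sink_node_def out_arcs_def reverse_arcs_def)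
    then show "head D a \<notin> S \<or> a \<notin> \<Union>\<B>" "tail D a \<notin> S \<or> a \<in> \<Union>\<B>"
      by (auto split: if_splits)
  qed
  have "?pot \<pi>"
  proof
    fix s assume "s \<in> arcs D \<times> (UNIV :: bool set)"
    then obtain a b where s: "s = (a, b)" "a \<in> arcs D" by auto
    show "\<pi> (step_end D s) \<le> \<pi> (step_start D s) + step_cost D S s"
      using diff[OF s(2)] rev[OF s(2)] unfolding s(1) step_cost_def
      by (cases b; cases "a \<in> \<Union>\<B>") (auto split: if_splits)
  qed
  then show "\<exists>\<pi>. ?pot \<pi>" by (rule exI[of _ \<pi>])
next
  assume "\<exists>\<pi>. ?pot \<pi>"
  then obtain \<pi> where pot: "?pot \<pi>" ..
  have up: "\<pi> (head D a) \<le> \<pi> (tail D a) + 1 - of_bool (head D a \<in> S)"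
    and down: "\<pi> (tail D a) \<le> \<pi> (head D a) - of_bool (tail D a \<in> S)" if "a \<in> arcs D" for a
    using pot[rule_format, of "(a, True)"] pot[rule_format, of "(a, False)"] that
    by (auto simp: step_cost_def)
  define Z where "Z k = {v \<in> verts D. k \<le> \<pi> v}" for k
  define \<B> where "\<B> = range (\<lambda>k. entering_arcs D (Z k))"
  have wf: "wf_digraph D" using D by (simp add: fin_digraph_def)
  have mem: "a \<in> entering_arcs D (Z k) \<longleftrightarrow> a \<in> arcs D \<and> \<pi> (tail D a) < k \<and> k \<le> \<pi> (head D a)" for a k
    using wf_digraph.head_in_verts[OF wf] wf_digraph.tail_in_verts[OF wf]
    by (auto simp: entering_arcs_def Z_def)
  have level: "k = \<pi> (head D a)" if "a \<in> entering_arcs D (Z k)" for a k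
    using that up[of a] unfolding mem by (auto split: if_splits simp: of_bool_def)
  have "dicut D B" if "B \<in> \<B>" for B
  proof -
    from that obtain k where B: "B = entering_arcs D (Z k)" by (auto simp: \<B>_def)
    have "\<pi> (tail D a) \<le> \<pi> (head D a)" if "a \<in> arcs D" for a
      using down[OF that] by (cases "tail D a \<in> S") auto
    then have "leaving_arcs D (Z k) = {}"
      using wf_digraph.head_in_verts[OF wf] by (fastforce simp: leaving_arcs_def Z_def)
    moreover have "Z k \<subseteq> verts D" by (auto simp: Z_def)
    ultimately show ?thesis unfolding dicut_def B by blast
  qed
  moreover have "pairwise disjnt \<B>"
    by (auto simp: pairwise_def disjnt_def \<B>_def dest: level)
  moreover have "sink_set (reverse_arcs D (\<Union>\<B>)) S"
  proof -
    have "a \<notin> \<Union>\<B>" if "a \<in> arcs D" "head D a \<in> S" for a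
      using up[OF that(1)] that by (auto simp: \<B>_def mem)
    moreover have "a \<in> \<Union>\<B>" if "a \<in> arcs D" "tail D a \<in> S" for a
      using down[OF that(1)] that by (auto simp: \<B>_def mem)
    ultimately have ends: "(if a \<in> \<Union>\<B> then head D a else tail D a) \<notin> S" if "a \<in> arcs D" for a
      using that by metis
    have "out_arcs (reverse_arcs D (\<Union>\<B>)) v = {}" if "v \<in> S" for v
    proof -
      have "tail (reverse_arcs D (\<Union>\<B>)) a \<noteq> v" if "a \<in> arcs D" for a
        using ends[OF that] \<open>v \<in> S\<close> unfolding reverse_arcs_def by fastforce
      then show ?thesis by (simp add: out_arcs_def reverse_arcs_def)
    qed
    then show ?thesis
      using S by (auto simp: sink_set_def sink_node_def reverse_arcs_def)
  qed
  ultimately show "sink_stable D S" unfolding sink_stable_def by blast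
qed

lemma length_filter_eq_card_Int:
  assumes "distinct (map f p)"
  shows "length (filter (\<lambda>s. f s \<in> S) p) = card (S \<inter> f ` set p)"
proof -
  have "length (filter (\<lambda>s. f s \<in> S) p) = length (filter (\<lambda>v. v \<in> S) (map f p))"
    by (simp add: filter_map comp_def)
  also have "\<dots> = card (S \<inter> f ` set p)"
    by (simp only: distinct_length_filter[OF assms]) (simp add: Int_def)
  finally show ?thesis .
qed

lemma sum_step_cost:
  assumes "distinct (map (step_end D) p)"
  shows "sum_list (map (step_cost D S) p) =
    int (num_forward p) - int (card (S \<inter> step_end D ` set p))"
proof -
  have "sum_list (map (step_cost D S) p) =
      int (num_forward p) - int (length (filter (\<lambda>s. step_end D s \<in> S) p))"
    by (induction p) (auto simp: step_cost_def num_forward_def)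
  then show ?thesis by (simp add: length_filter_eq_card_Int[OF assms])
qed

lemma sum_reversed_step_cost:
  assumes "distinct (map (step_start D) p)"
  shows "sum_list (map (\<lambda>s. step_cost D S (apsnd Not s)) p) =
    int (num_backward p) - int (card (S \<inter> step_start D ` set p))"
proof -
  have "sum_list (map (\<lambda>s. step_cost D S (apsnd Not s)) p) =
      int (num_backward p) - int (length (filter (\<lambda>s. step_start D s \<in> S) p))"
    by (induction p) (auto simp: step_cost_def num_backward_def)
  then show ?thesis by (simp add: length_filter_eq_card_Int[OF assms])
qed

text \<open>
  Around a closed walk the rises of \<open>\<pi>\<close> cancel, so the costs have a nonnegative sum. For a traversal
  this bounds \<open>card (S \<inter> verts C)\<close> by the number of forward steps, and running through the
  traversal backwards gives the bound by the number of backward steps.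
\<close>

lemma card_le_eta_if_potential:
  assumes D: "fin_digraph D" and C: "circuit D C"
    and pot: "\<And>s. s \<in> arcs D \<times> UNIV \<Longrightarrow> \<pi> (step_end D s) \<le> \<pi> (step_start D s) + step_cost D S s"
  shows "card (S \<inter> verts C) \<le> eta C"
proof -
  interpret fin_digraph D by fact
  note c = circuitD[OF C]
  have ends: "step_start C = step_start D" "step_end C = step_end D"
    using step_ends_cong[OF c(2,3)] .
  have "finite (arcs C)" using c(4) by (rule finite_subset) simp
  then obtain p where p: "traversal C p" using traversal_exists c by blast
  note once = traversal_visits_each_vertex_once[OF c(1,8) p, unfolded ends]
  have arc: "fst s \<in> arcs D" if "s \<in> set p" for s
    using p c(4) that by (auto simp: traversal_def)
  have "mset (map (step_end D) p) = mset (map (step_start D) p)"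
    using p by (intro mset_ends_eq_starts) (simp add: traversal_iff_rotate1 ends)
  then have "mset (map (\<pi> \<circ> step_end D) p) = mset (map (\<pi> \<circ> step_start D) p)"
    by (metis mset_map multiset.map_comp)
  then have eq: "sum_list (map (\<pi> \<circ> step_end D) p) = sum_list (map (\<pi> \<circ> step_start D) p)"
    by (metis sum_mset_sum_list)
  have "sum_list (map (\<pi> \<circ> step_end D) p) \<le>
      sum_list (map (\<lambda>s. (\<pi> \<circ> step_start D) s + step_cost D S s) p)"
    by (rule sum_list_mono) (use arc pot in \<open>force\<close>)
  then have "0 \<le> sum_list (map (step_cost D S) p)"
    by (simp add: sum_list_addf eq[unfolded o_def] o_def)
  then have fwd: "card (S \<inter> verts C) \<le> num_forward p"
    by (simp add: sum_step_cost[OF once(1)] once(2))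
  have "sum_list (map (\<pi> \<circ> step_start D) p) \<le>
      sum_list (map (\<lambda>s. (\<pi> \<circ> step_end D) s + step_cost D S (apsnd Not s)) p)"
  proof (rule sum_list_mono)
    fix s assume "s \<in> set p"
    from arc[OF this] have "apsnd Not s \<in> arcs D \<times> UNIV" by (cases s) auto
    from pot[OF this] show "(\<pi> \<circ> step_start D) s \<le> (\<pi> \<circ> step_end D) s + step_cost D S (apsnd Not s)"
      by (cases s) auto
  qed
  then have "0 \<le> sum_list (map (\<lambda>s. step_cost D S (apsnd Not s)) p)"
    by (simp add: sum_list_addf eq[unfolded o_def] o_def)
  then have "card (S \<inter> verts C) \<le> num_backward p"
    by (simp add: sum_reversed_step_cost[OF once(3)] once(4))
  with fwd show ?thesis by (simp add: eta_eq[OF c(1,8) p])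
qed

text \<open>
  A vertex of the cycle is entered once and left once; since no arc is repeated, these are two
  different arc ends, which make up its degree. This includes loops and pairs of parallel arcs.
\<close>

lemma circuit_of_cycle:
  assumes D: "fin_digraph D" and walk: "pre_digraph.awalk (step_digraph D) u p u"
    and ne: "p \<noteq> []" and ends: "distinct (map (step_end D) p)" and arcs: "distinct (map fst p)"
  defines "C \<equiv> \<lparr>verts = step_end D ` set p, arcs = fst ` set p, tail = tail D, head = head D\<rparr>"
  shows "circuit D C" "traversal C p"
proof -
  interpret fin_digraph D by fact
  interpret W: fin_digraph "step_digraph D" using D by (rule fin_step_digraph)
  have se: "step_start C = step_start D" "step_end C = step_end D"
    by (rule step_ends_cong; simp add: C_def)+
  have cas: "W.cas u p u" and sub: "fst ` set p \<subseteq> arcs D"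
    using walk by (force simp: W.awalk_def)+
  have rot: "map (step_end D) p = rotate1 (map (step_start D) p)"
    using closed_cas_imp_rotate1[OF cas ne] by simp
  then show "traversal C p"
    by (simp add: traversal_iff_rotate1 se arcs) (simp add: C_def)
  have ms: "mset (map (step_end D) p) = mset (map (step_start D) p)"
    using rot by (rule mset_ends_eq_starts)
  have starts: "step_start D ` set p = step_end D ` set p"
    using ms by (metis image_set mset_eq_setD)
  have start_mem: "step_start D s \<in> verts C" and end_mem: "step_end D s \<in> verts C"
    if "s \<in> set p" for s
    using that starts by (auto simp: C_def)
  have wfC: "wf_digraph C"
  proof
    fix a assume "a \<in> arcs C"
    then obtain b where "(a, b) \<in> set p" by (auto simp: C_def)
    from start_mem[OF this] end_mem[OF this]
    show "tail C a \<in> verts C" "head C a \<in> verts C" by (auto simp: C_def split: if_splits)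
  qed
  have "step_end D s \<in> verts D" if "s \<in> set p" for s
    using sub that by (cases s) force
  then have subg: "subgraph C D"
    using sub wfC by (auto simp: subgraph_def compatible_def C_def intro: wf_digraph_axioms)
  have deg: "in_degree C v + out_degree C v = 2" if v: "v \<in> verts C" for v
  proof -
    have "count_list (map (step_end D) p) v = 1"
      using v ends unfolding distinct_count_atmost_1 count_mset by (simp add: C_def)
    moreover have "count_list (map (step_start D) p) v = count_list (map (step_end D) p) v"
      using ms by (metis count_mset)
    ultimately show ?thesis
      using count_ends_plus_starts[OF arcs, of D v]
      by (simp add: in_degree_def out_degree_def in_arcs_def out_arcs_def C_def)
  qed
  interpret WC: wf_digraph "step_digraph C" using wfC by (rule wf_step_digraph)
  have "WC.cas x q y = W.cas x q y" for x q y
    by (induction q arbitrary: x) (auto simp: se)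
  moreover have u: "u \<in> verts C"
    using cas ne start_mem by (cases p) auto
  moreover have "set p \<subseteq> arcs C \<times> UNIV" by (force simp: C_def)
  ultimately have walkC: "WC.awalk u p u"
    using cas by (simp add: WC.awalk_def)
  have reach: "x \<in> verts C \<Longrightarrow> x \<in> set (WC.awalk_verts u p)" for x
    using WC.set_awalk_verts[OF walkC] by (auto simp: C_def se[unfolded C_def])
  have "strongly_connected (step_digraph C)"
    unfolding strongly_connected_def
  proof (intro conjI ballI)
    show "verts (step_digraph C) \<noteq> {}" using u by auto
    fix x y assume "x \<in> verts (step_digraph C)" "y \<in> verts (step_digraph C)"
    then show "x \<rightarrow>\<^sup>*\<^bsub>step_digraph C\<^esub> y"
      using WC.awalk_verts_reachable_to[OF walkC reach] WC.awalk_verts_reachable_from[OF walkC reach]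
      by (auto intro: WC.reachable_trans)
  qed
  then show "circuit D C"
    using subg deg by (simp add: circuit_def connected_iff_strongly_connected_step_digraph)
qed

text \<open>
  If an arc occurs in both directions, each of the two steps starts where the other ends. As a
  cycle leaves each vertex only once, the two steps are successors of each other.
\<close>

lemma repeated_arc_imp_two_steps:
  assumes dist: "distinct p" and ends: "distinct (map (step_end D) p)"
    and rot: "map (step_end D) p = rotate1 (map (step_start D) p)"
    and rep: "\<not> distinct (map fst p)"
  shows "\<exists>a. set p = {(a, True), (a, False)}"
proof -
  let ?n = "length p"
  have starts: "distinct (map (step_start D) p)"
    using ends rot by simp
  have succ: "Suc i mod ?n = j"
    if "i < ?n" "j < ?n" "step_end D (p ! i) = step_start D (p ! j)" for i j
  proof -
    have "step_start D (p ! (Suc i mod ?n)) = step_start D (p ! j)"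
      using rot that unfolding cyclic_chain_iff_rotate1[symmetric] by auto
    moreover have "Suc i mod ?n < ?n" using that by (cases ?n) auto
    ultimately show ?thesis
      using starts that by (metis length_map nth_eq_iff_index_eq nth_map)
  qed
  obtain i j where ij: "i < ?n" "j < ?n" "i \<noteq> j" "fst (p ! i) = fst (p ! j)"
    using rep by (auto simp: distinct_conv_nth)
  obtain a b where i: "p ! i = (a, b)" by force
  have "p ! j \<noteq> p ! i" using ij dist by (simp add: nth_eq_iff_index_eq)
  then have j: "p ! j = (a, \<not> b)" using ij(4) i by (cases "p ! j") auto
  have s1: "Suc i mod ?n = j" and s2: "Suc j mod ?n = i"
    using ij i j by (auto intro!: succ)
  have "?n = 2"
    using s1 s2 ij by (auto simp: mod_Suc split: if_splits)
  then have "set p = {p ! i, p ! j}"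
    using ij by (auto simp: in_set_conv_nth less_2_cases_iff)
  then have "set p = {(a, True), (a, False)}" unfolding i j by (cases b) auto
  then show ?thesis ..
qed

lemma cycle_cost_nonneg:
  assumes D: "fin_digraph D" and S: "stable_set D S"
    and circ: "\<And>C. circuit D C \<Longrightarrow> card (S \<inter> verts C) \<le> eta C"
    and cyc: "pre_digraph.cycle (step_digraph D) p"
  shows "0 \<le> sum_list (map (step_cost D S) p)"
proof -
  interpret W: fin_digraph "step_digraph D" using D by (rule fin_step_digraph)
  obtain u where walk: "W.awalk u p u" and tl: "distinct (tl (W.awalk_verts u p))"
    and ne: "p \<noteq> []" and dist: "distinct p"
    using cyc unfolding W.cycle_conv by blast
  have cas: "W.cas u p u" using walk by (auto simp: W.awalk_def)
  have ends: "distinct (map (step_end D) p)"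
    using tl ne W.awalk_verts_conv'[OF cas] by simp
  have cost: "sum_list (map (step_cost D S) p) =
      int (num_forward p) - int (card (S \<inter> step_end D ` set p))"
    using ends by (rule sum_step_cost)
  show ?thesis
  proof (cases "distinct (map fst p)")
    case True
    define C where
      "C = \<lparr>verts = step_end D ` set p, arcs = fst ` set p, tail = tail D, head = head D\<rparr>"
    have C: "circuit D C" and p: "traversal C p"
      unfolding C_def by (rule circuit_of_cycle[OF D walk ne ends True])+
    have "card (S \<inter> verts C) \<le> num_forward p"
      using circ[OF C] by (simp add: eta_eq[OF circuitD(1,8)[OF C] p])
    then show ?thesis unfolding cost by (simp add: C_def)
  next
    case False
    then obtain a where set: "set p = {(a, True), (a, False)}"
      using repeated_arc_imp_two_steps[OF dist ends] closed_cas_imp_rotate1[OF cas ne] by auto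
    have a: "a \<in> arcs D" using walk set by (auto simp: W.awalk_def)
    have "head D a \<noteq> tail D a"
      using ends set by (auto simp: distinct_map inj_on_def)
    then have "head D a \<notin> S \<or> tail D a \<notin> S"
      using S a by (metis stable_set_def)
    then have "0 \<le> step_cost D S (a, True) + step_cost D S (a, False)"
      by (auto simp: step_cost_def)
    also have "\<dots> = sum_list (map (step_cost D S) p)"
      using dist by (simp add: sum_list_distinct_conv_sum_set set)
    finally show ?thesis .
  qed
qed

section \<open>The characterisation\<close>

theorem theorem3p1:
  fixes D :: "('a, 'b) pre_digraph" and S :: "'a set"
  assumes "fin_digraph D" and "stable_set D S"
  shows "sink_stable D S \<longleftrightarrow> (\<forall>C. circuit D C \<longrightarrow> card (S \<inter> verts C) \<le> eta C)"
proof -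
  interpret W: fin_digraph "step_digraph D" using assms(1) by (rule fin_step_digraph)
  have "S \<subseteq> verts D" using assms(2) by (simp add: stable_set_def)
  note pot_iff = sink_stable_iff_potential[OF assms(1) this]
  show ?thesis
  proof
    assume "sink_stable D S"
    then obtain \<pi> where
      "\<forall>s\<in>arcs D \<times> UNIV. \<pi> (step_end D s) \<le> \<pi> (step_start D s) + step_cost D S s"
      unfolding pot_iff ..
    then show "\<forall>C. circuit D C \<longrightarrow> card (S \<inter> verts C) \<le> eta C"
      using card_le_eta_if_potential[OF assms(1)] by blast
  next
    assume "\<forall>C. circuit D C \<longrightarrow> card (S \<inter> verts C) \<le> eta C"
    then have "0 \<le> sum_list (map (step_cost D S) p)" if "W.cycle p" for p
      using cycle_cost_nonneg[OF assms _ that] by blast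
    from W.potential_if_no_negative_cycle[OF this]
    show "sink_stable D S" unfolding pot_iff by simp
  qed
qed

end
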